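(* Let $N\ge 2$ be an integer and let $A$ be an $N\times N$ complex unitary matrix all of whose first-row entries equal $1/\sqrt N$. Let $(W_{n,A})_{n\ge 0}$ be the generalized Walsh functions associated to $A$. Let $f:[0,1]\to\mathbb C$ be Lebesgue integrable and continuous in a neighborhood (in $[0,1]$) of a point $a\in[0,1]$. Then there is $\delta>0$ such that, as $q\to\infty$, the partial sums $$S_{N^q}(x)=\sum_{n=0}^{N^q-1}\langle f, W_{n,A}\rangle W_{n,A}(x)$$ converge to $f(x)$ uniformly for $x\in(a-\delta,a+\delta)\cap[0,1]$.
   Context: Generalized Walsh functions. Write $A=[a_{ij}]_{0\le i,j\le N-1}$, a complex unitary $N\times N$ matrix with $a_{0j}=1/\sqrt N$ for all $j$. For $0\le i\le N-1$ let $m_i(x)=\sqrt N\sum_{j=0}^{N-1}a_{ij}\chi_{[j/N,(j+1)/N)}(x)$ for $x\in[0,1)$, so $m_0\equiv 1$. Let $r(x)=(Nx)\bmod 1$, i.e. $r(x)=Nx-l$ for $x\in[l/N,(l+1)/N)$, $l\in\{0,\dots,N-1\}$. At the endpoint $x=1$ the convention is $r(1)=1$ and $m_i(1)=\sqrt N a_{i,N-1}$. For an integer $n\ge 0$ with base-$N$ expansion $n=\sum_{k=0}^{p-1}i_kN^k$, $i_k\in\{0,\dots,N-1\}$, set $$W_{n,A}(x)=m_{i_0}(x)\,m_{i_1}(r x)\cdots m_{i_{p-1}}(r^{p-1}x),$$ where $r^k$ is the $k$-fold iterate of $r$; $W_{0,A}\equiv1$. Functions are complex valued and $\langle f,g\rangle=\int_0^1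 f(t)\overline{g(t)}\,dt$. *)

theory Defs
  imports
    "HOL-Analysis.Analysis"
    "Jordan_Normal_Form.Schur_Decomposition"
begin

definition unitary_mat :: "complex mat \<Rightarrow> bool" where
  "unitary_mat A \<longleftrightarrow>
     square_mat A \<and> inverts_mat A (mat_adjoint A) \<and> inverts_mat (mat_adjoint A) A"

text \<open>
  All functions on \<open>[0, 1]\<close> are total functions on \<^typ>\<open>real\<close>; their values outside
  \<open>[0, 1]\<close> are irrelevant. At the right endpoint, \<open>r(1) = 1\<close> and
  \<open>m\<^sub>i(1)\<close> is the value of \<open>m\<^sub>i\<close> on the last interval \<open>[(N - 1)/N, 1)\<close>.
\<close>

definition walsh_r :: "nat \<Rightarrow> real \<Rightarrow> real" where
  "walsh_r N x = (if x = 1 then 1 else frac (real N * x))"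

definition walsh_m :: "nat \<Rightarrow> complex mat \<Rightarrow> nat \<Rightarrow> real \<Rightarrow> complex" where
  "walsh_m N A i x =
     (if x = 1 then complex_of_real (sqrt (real N)) * A $$ (i, N - 1)
      else complex_of_real (sqrt (real N)) *
        (\<Sum>j<N. A $$ (i, j) * indicator {real j / real N ..< real (j + 1) / real N} x))"

text \<open>The number of base-\<open>N\<close> digits of \<open>n\<close>, without leading zeros; it is \<open>0\<close> for \<open>n = 0\<close>.\<close>

definition num_digits :: "nat \<Rightarrow> nat \<Rightarrow> nat" where
  "num_digits N n = (LEAST p. n < N ^ p)"

definition walsh :: "nat \<Rightarrow> complex mat \<Rightarrow> nat \<Rightarrow> real \<Rightarrow> complex" where
  "walsh N A n x =
     (\<Prod>k<num_digits N n. walsh_m N A (n div N ^ k mod N) ((walsh_r N ^^ k) x))"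

definition inner01 :: "(real \<Rightarrow> complex) \<Rightarrow> (real \<Rightarrow> complex) \<Rightarrow> complex" where
  "inner01 f g = (LINT t:{0..1}|lebesgue. f t * cnj (g t))"

definition walsh_partial_sum ::
    "nat \<Rightarrow> complex mat \<Rightarrow> (real \<Rightarrow> complex) \<Rightarrow> nat \<Rightarrow> real \<Rightarrow> complex" where
  "walsh_partial_sum N A f M x = (\<Sum>n<M. inner01 f (walsh N A n) * walsh N A n x)"

end

theory Submission
  imports Defs
begin

text \<open>
  The partial sums of order \<open>N\<^sup>q\<close> are averages of \<open>f\<close>. Writing \<open>n < N\<^sup>q\<close> in base \<open>N\<close> with
  exactly \<open>q\<close> digits, the sum over \<open>n\<close> becomes a sum over all digit strings, and the Dirichlet
  kernel factorizes:
  \<open>\<Sum>n<N\<^sup>q. W\<^sub>n(x) cnj W\<^sub>n(t) = \<Prod>k<q. \<Sum>i<N. m\<^sub>i(r\<^sup>k x) cnj m\<^sub>i(r\<^sup>k t)\<close>.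
  Since \<open>m\<^sub>i(x)\<close> is \<open>\<surd>N\<close> times the entry of \<open>A\<close> in row \<open>i\<close> and the column named by the first
  base-\<open>N\<close> digit of \<open>x\<close>, orthonormality of the columns of \<open>A\<close> makes each factor equal to \<open>N\<close> if
  \<open>r\<^sup>k x\<close> and \<open>r\<^sup>k t\<close> have the same first digit, and to \<open>0\<close> otherwise. Hence the kernel is \<open>N\<^sup>q\<close>
  times the indicator of the event that \<open>x\<close> and \<open>t\<close> lie in the same \<open>N\<close>-adic interval of
  length \<open>N\<^sup>-\<^sup>q\<close> (\<open>walsh_kernel\<close>).
  
  Consequently the partial sum at \<open>x\<close> is the mean of \<open>f\<close> over the \<open>N\<close>-adic interval around \<open>x\<close>
  (\<open>walsh_partial_sum_eq_cell_integral\<close>), and it differs from \<open>f(x)\<close> by at most the oscillation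
  of \<open>f\<close> within distance \<open>N\<^sup>-\<^sup>q\<close> of \<open>x\<close> (\<open>walsh_partial_sum_approx\<close>). Near \<open>a\<close> the function is
  uniformly continuous on a compact interval, so this oscillation tends to \<open>0\<close> uniformly.
\<close>

section \<open>Base-\<open>N\<close> digits and the map \<open>r\<close>\<close>

text \<open>
  The position of \<open>x\<close> among the \<open>N\<^sup>q\<close> intervals of length \<open>N\<^sup>-\<^sup>q\<close>; for \<open>q = 1\<close> this is the first
  base-\<open>N\<close> digit of \<open>x\<close>. The convention \<open>r(1) = 1\<close> gives the point \<open>1\<close> only digits \<open>N - 1\<close>, which
  puts it in the last interval.
\<close>

definition adic_index :: "nat \<Rightarrow> nat \<Rightarrow> real \<Rightarrow> nat" where
  "adic_index N q x = (if x = 1 then N ^ q - 1 else nat \<lfloor>real N ^ q * x\<rfloor>)"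

lemma adic_index_less:
  assumes "N > 0" "x \<in> {0..1}"
  shows "adic_index N q x < N ^ q"
proof (cases "x = 1")
  case False
  with assms have "real N ^ q * x < real N ^ q * 1"
    by (intro mult_strict_left_mono) auto
  hence "\<lfloor>real N ^ q * x\<rfloor> < int (N ^ q)" by (simp add: floor_less_iff)
  thus ?thesis using False assms by (simp add: adic_index_def nat_less_iff)
qed (use assms in \<open>simp add: adic_index_def\<close>)

lemma walsh_r_in_unit_interval: "walsh_r N x \<in> {0..1}"
  using frac_ge_0[of "real N * x"] frac_lt_1[of "real N * x"] by (auto simp: walsh_r_def)

lemma walsh_r_iterate_in_unit_interval: "x \<in> {0..1} \<Longrightarrow> (walsh_r N ^^ k) x \<in> {0..1}"
  by (cases k) (use walsh_r_in_unit_interval in auto)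

text \<open>
  The first digit of \<open>x\<close> is the most significant one, and \<open>r\<close> shifts it out: with \<open>y = N x\<close> this is
  \<open>\<lfloor>N\<^sup>q y\<rfloor> = N\<^sup>q \<lfloor>y\<rfloor> + \<lfloor>N\<^sup>q frac y\<rfloor>\<close>.
\<close>

lemma adic_index_Suc:
  assumes "N > 0" "x \<in> {0..1}"
  shows "adic_index N (Suc q) x = N ^ q * adic_index N 1 x + adic_index N q (walsh_r N x)"
proof (cases "x = 1")
  case True
  have "N * N ^ q - 1 = N ^ q * (N - 1) + (N ^ q - 1)"
    using assms by (cases N) (auto simp: algebra_simps)
  thus ?thesis using True by (simp add: adic_index_def walsh_r_def)
next
  case False
  define y where "y = real N * x"
  have y: "y \<ge> 0" using assms by (simp add: y_def)
  have "real N ^ Suc q * x = of_int (int N ^ q * \<lfloor>y\<rfloor>) + real N ^ q * frac y"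
    by (simp add: y_def frac_def algebra_simps)
  hence "\<lfloor>real N ^ Suc q * x\<rfloor> = int N ^ q * \<lfloor>y\<rfloor> + \<lfloor>real N ^ q * frac y\<rfloor>"
    by (metis floor_add_int add.commute)
  moreover have "\<lfloor>real N ^ q * frac y\<rfloor> \<ge> 0" by simp
  moreover have "frac y \<noteq> 1" using frac_lt_1[of y] by simp
  ultimately show ?thesis using False y
    by (simp add: adic_index_def walsh_r_def y_def[symmetric] nat_add_distrib
        nat_mult_distrib nat_power_eq)
qed

text \<open>
  Uniqueness of division with remainder, since the index of \<open>r x\<close> stays below \<open>N\<^sup>q\<close>. Iterated, it
  says that the first \<open>q\<close> digits determine the \<open>N\<close>-adic interval, which is what identifies the
  Dirichlet kernel below.
\<close>

lemma adic_index_Suc_eq_iff: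
  assumes "N > 0" "x \<in> {0..1}" "t \<in> {0..1}"
  shows "adic_index N (Suc q) x = adic_index N (Suc q) t \<longleftrightarrow>
    adic_index N 1 x = adic_index N 1 t \<and>
    adic_index N q (walsh_r N x) = adic_index N q (walsh_r N t)"
proof -
  have eq: "a = c \<and> b = d" if "K * a + b = K * c + d" "b < K" "d < K" for K a b c d :: nat
  proof -
    have "(K * a + b) div K = (K * c + d) div K" using that(1) by simp
    hence "a = c" using that(2,3) by simp
    thus ?thesis using that(1) by simp
  qed
  show ?thesis
    using eq[OF _ adic_index_less adic_index_less, OF _ assms(1) walsh_r_in_unit_interval
        assms(1) walsh_r_in_unit_interval]
    by (auto simp only: adic_index_Suc[OF assms(1,2)] adic_index_Suc[OF assms(1,3)])
qed

section \<open>The Dirichlet kernel\<close>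

lemma unitary_mat_columns_orthonormal:
  assumes A: "A \<in> carrier_mat N N" "unitary_mat A" and j: "j < N" and l: "l < N"
  shows "(\<Sum>i<N. A $$ (i, j) * cnj (A $$ (i, l))) = (if j = l then 1 else 0)"
proof -
  have d: "dim_row A = N" "dim_col A = N" using A by auto
  have "mat_adjoint A * A = 1\<^sub>m N"
    using A d by (simp add: unitary_mat_def inverts_mat_def mat_adjoint_def)
  hence "(mat_adjoint A * A) $$ (l, j) = (if j = l then 1 else 0)"
    using j l by auto
  moreover have "(mat_adjoint A * A) $$ (l, j) = (\<Sum>i<N. cnj (A $$ (i, l)) * A $$ (i, j))"
    using j l d
    by (simp add: mat_adjoint_def scalar_prod_def lessThan_atLeast0 mat_of_rows_index conjugate_complex_def)
  ultimately show ?thesis by (simp only: mult.commute)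
qed

lemma walsh_m_eq_entry:
  assumes "N > 0" "x \<in> {0..1}"
  shows "walsh_m N A i x = complex_of_real (sqrt (real N)) * A $$ (i, adic_index N 1 x)"
proof (cases "x = 1")
  case False
  define d where "d = adic_index N 1 x"
  have d: "d < N" using adic_index_less[OF assms, of 1] by (simp add: d_def)
  have ind: "x \<in> {real j / real N ..< real (j + 1) / real N} \<longleftrightarrow> j = d" for j
  proof -
    have "x \<in> {real j / real N ..< real (j + 1) / real N} \<longleftrightarrow>
        real j \<le> real N * x \<and> real N * x < real j + 1"
      using assms by (simp add: field_simps)
    also have "\<dots> \<longleftrightarrow> \<lfloor>real N * x\<rfloor> = int j" by (auto simp: floor_eq_iff)
    also have "\<dots> \<longleftrightarrow> j = d" using False assms by (auto simp: d_def adic_index_def)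
    finally show ?thesis .
  qed
  have "(\<Sum>j<N. A $$ (i, j) * indicator {real j / real N ..< real (j + 1) / real N} x)
      = (\<Sum>j<N. if j = d then A $$ (i, j) else 0)"
    by (intro sum.cong refl) (simp only: indicator_def ind, simp)
  also have "\<dots> = A $$ (i, d)" using d by simp
  finally show ?thesis using False by (simp add: walsh_m_def d_def)
qed (simp add: walsh_m_def adic_index_def)

text \<open>
  The case \<open>q = 1\<close> of the kernel formula: the left side is \<open>N\<close> times the inner product of two
  columns of \<open>A\<close>.
\<close>

lemma walsh_m_kernel:
  assumes "N > 0" "A \<in> carrier_mat N N" "unitary_mat A" "x \<in> {0..1}" "t \<in> {0..1}"
  shows "(\<Sum>i<N. walsh_m N A i x * cnj (walsh_m N A i t)) =
    (if adic_index N 1 x = adic_index N 1 t then of_nat N else 0)"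
proof -
  have sq: "complex_of_real (sqrt (real N)) * complex_of_real (sqrt (real N)) = of_nat N"
    by (simp flip: of_real_mult)
  have "(\<Sum>i<N. walsh_m N A i x * cnj (walsh_m N A i t)) = (\<Sum>i<N.
      (complex_of_real (sqrt (real N)) * complex_of_real (sqrt (real N))) *
      (A $$ (i, adic_index N 1 x) * cnj (A $$ (i, adic_index N 1 t))))"
    using assms by (simp add: walsh_m_eq_entry mult_ac)
  also have "\<dots> = of_nat N * (\<Sum>i<N. A $$ (i, adic_index N 1 x) * cnj (A $$ (i, adic_index N 1 t)))"
    unfolding sq by (simp add: sum_distrib_left)
  also have "\<dots> = (if adic_index N 1 x = adic_index N 1 t then of_nat N else 0)"
    using adic_index_less[OF assms(1,4), of 1] adic_index_less[OF assms(1,5), of 1]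
    by (subst unitary_mat_columns_orthonormal[OF assms(2,3)]) auto
  finally show ?thesis .
qed

text \<open>
  The distributive law in disguise: as \<open>n\<close> runs through the numbers below \<open>N\<^sup>q\<close>, its digits run
  through all strings of length \<open>q\<close>. The induction splits off the leading digit \<open>i\<close> by writing
  \<open>n = m + i N\<^sup>q\<close> with \<open>m < N\<^sup>q\<close>.
\<close>

lemma sum_prod_base_digits:
  fixes g :: "nat \<Rightarrow> nat \<Rightarrow> 'a :: comm_semiring_1"
  assumes "N > 0"
  shows "(\<Sum>n<N ^ q. \<Prod>k<q. g k (n div N ^ k mod N)) = (\<Prod>k<q. \<Sum>i<N. g k i)"
proof (induction q)
  case (Suc q)
  have low: "(m + i * N ^ q) div N ^ k mod N = m div N ^ k mod N" if kq: "k < q" for m i k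
  proof -
    obtain e where e: "q = k + Suc e" using less_imp_Suc_add[OF kq] by auto
    have shift: "m + i * N ^ q = m + N ^ k * (N * (i * N ^ e))" unfolding e power_add by simp
    have "(m + i * N ^ q) div N ^ k = m div N ^ k + N * (i * N ^ e)"
      unfolding shift using assms by simp
    thus ?thesis by simp
  qed
  have "(\<Sum>n<N ^ Suc q. \<Prod>k<Suc q. g k (n div N ^ k mod N)) =
      (\<Sum>i<N. \<Sum>n=i * N ^ q..<i * N ^ q + N ^ q. \<Prod>k<Suc q. g k (n div N ^ k mod N))"
    by (simp only: power_Suc sum.nat_group)
  also have "\<dots> = (\<Sum>i<N. \<Sum>m<N ^ q. \<Prod>k<Suc q. g k ((m + i * N ^ q) div N ^ k mod N))"
  proof (rule sum.cong[OF refl])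
    fix i :: nat
    show "(\<Sum>n=i * N ^ q..<i * N ^ q + N ^ q. \<Prod>k<Suc q. g k (n div N ^ k mod N)) =
        (\<Sum>m<N ^ q. \<Prod>k<Suc q. g k ((m + i * N ^ q) div N ^ k mod N))"
      by (rule sum.reindex_bij_witness[of _ "\<lambda>m. m + i * N ^ q" "\<lambda>n. n - i * N ^ q"]) auto
  qed
  also have "\<dots> = (\<Sum>i<N. \<Sum>m<N ^ q. (\<Prod>k<q. g k (m div N ^ k mod N)) * g q i)"
    using assms by (intro sum.cong refl) (simp add: low)
  also have "\<dots> = (\<Prod>k<Suc q. \<Sum>i<N. g k i)"
    by (simp only: prod.lessThan_Suc Suc.IH[symmetric] sum_product) (rule sum.swap)
  finally show ?case .
qed simp

text \<open>
  Leading zeros do not change the product because \<open>m\<^sub>0 = 1\<close>, which is what the hypothesis on the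
  first row of \<open>A\<close> provides. Thus all \<open>n < N\<^sup>q\<close> can be treated with the same number of digits.
\<close>

lemma walsh_eq_padded_prod:
  assumes "N \<ge> 2" "\<And>j. j < N \<Longrightarrow> A $$ (0, j) = 1 / complex_of_real (sqrt (real N))"
    and "x \<in> {0..1}" "n < N ^ q"
  shows "walsh N A n x = (\<Prod>k<q. walsh_m N A (n div N ^ k mod N) ((walsh_r N ^^ k) x))"
proof -
  have n: "n < N ^ num_digits N n" unfolding num_digits_def using assms(4) by (rule LeastI)
  have le: "num_digits N n \<le> q" unfolding num_digits_def using assms(4) by (rule Least_le)
  have "walsh_m N A (n div N ^ k mod N) ((walsh_r N ^^ k) x) = 1" if "k \<ge> num_digits N n" for k
  proof -
    have "N ^ num_digits N n \<le> N ^ k" using assms(1) that by (intro power_increasing) auto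
    hence "n div N ^ k = 0" using n by simp
    thus ?thesis
      using assms(1,2) adic_index_less[of N "(walsh_r N ^^ k) x" 1, OF _ walsh_r_iterate_in_unit_interval[OF assms(3)]]
        walsh_r_iterate_in_unit_interval[OF assms(3), where N = N and k = k]
      by (simp add: walsh_m_eq_entry)
  qed
  thus ?thesis unfolding walsh_def using le
    by (intro prod.mono_neutral_left) auto
qed

text \<open>
  Both products have \<open>q\<close> factors after padding, so the sum over \<open>n\<close> turns into a product of
  \<open>q\<close> one-digit kernels, which is then compared with the interval index one digit at a time.
\<close>

lemma walsh_kernel:
  assumes "N \<ge> 2" "A \<in> carrier_mat N N" "unitary_mat A"
    and "\<And>j. j < N \<Longrightarrow> A $$ (0, j) = 1 / complex_of_real (sqrt (real N))"
    and "x \<in> {0..1}" "t \<in> {0..1}"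
  shows "(\<Sum>n<N ^ q. walsh N A n x * cnj (walsh N A n t)) =
    (if adic_index N q x = adic_index N q t then of_nat (N ^ q) else 0)"
proof -
  let ?r = "\<lambda>k. walsh_r N ^^ k"
  have N: "N > 0" using assms(1) by simp
  have "(\<Sum>n<N ^ q. walsh N A n x * cnj (walsh N A n t)) =
      (\<Sum>n<N ^ q. \<Prod>k<q. walsh_m N A (n div N ^ k mod N) (?r k x) *
        cnj (walsh_m N A (n div N ^ k mod N) (?r k t)))"
    using assms by (intro sum.cong refl) (simp add: walsh_eq_padded_prod prod.distrib)
  also have "\<dots> = (\<Prod>k<q. \<Sum>i<N. walsh_m N A i (?r k x) * cnj (walsh_m N A i (?r k t)))"
    by (rule sum_prod_base_digits[OF N])
  also have "\<dots> = (if adic_index N q x = adic_index N q t then of_nat (N ^ q) else 0)"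
    using assms(5,6)
  proof (induction q arbitrary: x t)
    case 0
    show ?case using adic_index_less[OF N 0(1), where q = 0] adic_index_less[OF N 0(2), where q = 0] by simp
  next
    case (Suc q)
    have "(\<Prod>k<Suc q. \<Sum>i<N. walsh_m N A i (?r k x) * cnj (walsh_m N A i (?r k t))) =
        (\<Sum>i<N. walsh_m N A i x * cnj (walsh_m N A i t)) *
        (\<Prod>k<q. \<Sum>i<N. walsh_m N A i (?r k (walsh_r N x)) * cnj (walsh_m N A i (?r k (walsh_r N t))))"
      by (simp only: prod.lessThan_Suc_shift funpow_Suc_right funpow_0 o_apply)
    also have "\<dots> = (if adic_index N (Suc q) x = adic_index N (Suc q) t then of_nat (N ^ Suc q) else 0)"
      unfolding Suc.IH[OF walsh_r_in_unit_interval walsh_r_in_unit_interval]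
        walsh_m_kernel[OF N assms(2,3) Suc.prems] adic_index_Suc_eq_iff[OF N Suc.prems]
      by simp
    finally show ?case .
  qed
  finally show ?thesis .
qed

section \<open>The \<open>N\<close>-adic intervals\<close>

definition adic_cell :: "nat \<Rightarrow> nat \<Rightarrow> real \<Rightarrow> real set" where
  "adic_cell N q x = {t \<in> {0..1}. adic_index N q t = adic_index N q x}"

text \<open>
  The cells are half-open, except that the last one also contains the endpoint \<open>1\<close>. Only the length
  of a cell matters for averaging, so its left endpoint is merely asserted to exist.
\<close>

lemma adic_cell_eq_interval:
  fixes q :: nat
  assumes "N > 0" "x \<in> {0..1}"
  defines "K \<equiv> real N ^ q"
  obtains c where "adic_cell N q x = {c..<c + 1 / K} \<or> adic_cell N q x = {c..c + 1 / K}"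
proof
  define j where "j = adic_index N q x"
  have K: "K > 0" "real (N ^ q) = K" using assms by (simp_all add: K_def)
  have j: "j < N ^ q" unfolding j_def by (rule adic_index_less[OF assms(1,2)])
  hence jK: "real j + 1 \<le> K"
    by (metis K(2) Suc_eq_plus1 Suc_leI of_nat_1 of_nat_add of_nat_le_iff)
  have below_1: "t \<in> adic_cell N q x \<longleftrightarrow> real j / K \<le> t \<and> t < (real j + 1) / K" if "t \<noteq> 1" for t
  proof -
    have "t \<in> adic_cell N q x \<longleftrightarrow> t \<in> {0..1} \<and> nat \<lfloor>K * t\<rfloor> = j"
      using that by (simp add: adic_cell_def j_def[symmetric] adic_index_def[of N q t] K_def)
    also have "\<dots> \<longleftrightarrow> t \<in> {0..1} \<and> \<lfloor>K * t\<rfloor> = int j"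
      using K by (auto simp: nat_eq_iff)
    also have "\<dots> \<longleftrightarrow> t \<in> {0..1} \<and> real j / K \<le> t \<and> t < (real j + 1) / K"
      using K by (auto simp: floor_eq_iff field_simps)
    also have "\<dots> \<longleftrightarrow> real j / K \<le> t \<and> t < (real j + 1) / K"
    proof -
      have "0 \<le> real j / K" "(real j + 1) / K \<le> 1" using K jK by auto
      thus ?thesis by auto
    qed
    finally show ?thesis .
  qed
  have at_1: "1 \<in> adic_cell N q x \<longleftrightarrow> j = N ^ q - 1"
    by (auto simp: adic_cell_def j_def[symmetric] adic_index_def[of N q 1])
  show "adic_cell N q x = {real j / K..<real j / K + 1 / K} \<or>
    adic_cell N q x = {real j / K..real j / K + 1 / K}"
  proof (cases "j = N ^ q - 1")
    case True
    hence jK: "real j + 1 = K" using K j by (simp add: of_nat_diff Suc_leI)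
    have "t \<in> adic_cell N q x \<longleftrightarrow> t \<in> {real j / K..real j / K + 1 / K}" for t
    proof (cases "t = 1")
      case t: True
      show ?thesis using t at_1 True K jK
        by (simp add: add_divide_distrib[symmetric])
    next
      case t: False
      show ?thesis using t below_1[OF t] K jK by (auto simp: add_divide_distrib[symmetric])
    qed
    thus ?thesis by blast
  next
    case False
    hence "Suc j < N ^ q" using j by simp
    hence "real j + 1 < K" by (metis K(2) Suc_eq_plus1 of_nat_1 of_nat_add of_nat_less_iff)
    hence "(real j + 1) / K < 1" using K by simp
    hence "t \<in> adic_cell N q x \<longleftrightarrow> t \<in> {real j / K..<real j / K + 1 / K}" for t
      using at_1 False below_1[of t]
      by (cases "t = 1") (auto simp: add_divide_distrib[symmetric])
    thus ?thesis by blast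
  qed
qed

lemma adic_cell_properties:
  assumes "N > 0" "x \<in> {0..1}"
  shows adic_cell_lmeasurable: "adic_cell N q x \<in> lmeasurable"
    and measure_adic_cell: "measure lebesgue (adic_cell N q x) = 1 / real N ^ q"
    and adic_cell_diameter: "t \<in> adic_cell N q x \<Longrightarrow> \<bar>t - x\<bar> \<le> 1 / real N ^ q"
    and adic_cell_subset: "adic_cell N q x \<subseteq> {0..1}"
proof -
  obtain c where c: "adic_cell N q x = {c..<c + 1 / real N ^ q} \<or>
      adic_cell N q x = {c..c + 1 / real N ^ q}"
    using adic_cell_eq_interval[OF assms] .
  have x: "x \<in> adic_cell N q x" using assms by (simp add: adic_cell_def)
  show "adic_cell N q x \<in> lmeasurable"
    using c by (auto intro: bounded_set_imp_lmeasurable)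
  show "measure lebesgue (adic_cell N q x) = 1 / real N ^ q"
    using c assms by auto
  show "t \<in> adic_cell N q x \<Longrightarrow> \<bar>t - x\<bar> \<le> 1 / real N ^ q"
    using c x by auto
  show "adic_cell N q x \<subseteq> {0..1}" by (auto simp: adic_cell_def)
qed

section \<open>Partial sums as averages\<close>

lemma walsh_m_measurable [measurable]: "walsh_m N A i \<in> borel_measurable borel"
  unfolding walsh_m_def[abs_def] by measurable

lemma walsh_r_measurable [measurable]: "walsh_r N \<in> borel_measurable borel"
  unfolding walsh_r_def[abs_def] frac_def by measurable

lemma walsh_measurable: "walsh N A n \<in> borel_measurable borel"
  unfolding walsh_def[abs_def] by measurable

text \<open>
  Boundedness is used only to make \<open>f\<close> times a Walsh function integrable, so a crude bound on each
  factor suffices.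
\<close>

lemma walsh_bounded: "\<exists>C. \<forall>x. norm (walsh N A n x) \<le> C"
proof -
  define B where "B i = sqrt (real N) * (norm (A $$ (i, N - 1)) + (\<Sum>j<N. norm (A $$ (i, j))))" for i
  have "norm (walsh_m N A i x) \<le> B i" for i x
  proof (cases "x = 1")
    case True
    have "sqrt (real N) * norm (A $$ (i, N - 1)) \<le> B i"
      unfolding B_def by (intro mult_left_mono) (auto intro: sum_nonneg)
    thus ?thesis using True by (simp add: walsh_m_def norm_mult)
  next
    case False
    let ?S = "\<Sum>j<N. A $$ (i, j) * indicator {real j / real N ..< real (j + 1) / real N} x"
    have "norm ?S \<le> (\<Sum>j<N. norm (A $$ (i, j)))"
      by (rule sum_norm_le) (simp add: norm_mult indicator_def)
    hence "sqrt (real N) * norm ?S \<le> B i"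
      unfolding B_def by (intro mult_left_mono) (auto intro: add_increasing)
    thus ?thesis using False by (simp add: walsh_m_def norm_mult)
  qed
  hence "norm (walsh N A n x) \<le> (\<Prod>k<num_digits N n. B (n div N ^ k mod N))" for x
    unfolding walsh_def prod_norm[symmetric] by (intro prod_mono) auto
  thus ?thesis by blast
qed

lemma set_integrable_mult_cnj_walsh:
  assumes "set_integrable lebesgue {0..1} f"
  shows "set_integrable lebesgue {0..1} (\<lambda>t. f t * cnj (walsh N A n t))"
proof -
  obtain C where C: "\<And>x. norm (walsh N A n x) \<le> C" using walsh_bounded by blast
  have W: "walsh N A n \<in> borel_measurable lebesgue"
    using walsh_measurable by (simp add: measurable_completion)
  have int: "integrable lebesgue (\<lambda>t. indicator {0..1} t *\<^sub>R f t)"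
    using assms by (simp add: set_integrable_def)
  have "(\<lambda>t. cnj (walsh N A n t)) \<in> borel_measurable lebesgue"
    using measurable_compose[OF W, of cnj borel]
    by (simp add: borel_measurable_continuous_onI continuous_on_cnj)
  hence meas: "(\<lambda>t. (indicator {0..1} t *\<^sub>R f t) * cnj (walsh N A n t)) \<in> borel_measurable lebesgue"
    using borel_measurable_integrable[OF int] by (rule borel_measurable_times[rotated])
  have bound: "norm ((indicator {0..1} t *\<^sub>R f t) * cnj (walsh N A n t)) \<le>
      norm (C *\<^sub>R (indicator {0..1} t *\<^sub>R f t))" for t
  proof -
    have "norm (walsh N A n t) \<le> \<bar>C\<bar>" using C[of t] by linarith
    thus ?thesis by (auto simp: norm_mult indicator_def mult.commute[of "\<bar>C\<bar>"] intro: mult_left_mono)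
  qed
  have "integrable lebesgue (\<lambda>t. (indicator {0..1} t *\<^sub>R f t) * cnj (walsh N A n t))"
    by (rule Bochner_Integration.integrable_bound[OF integrable_scaleR_right[OF int, of C] meas])
      (rule AE_I2, rule bound)
  thus ?thesis unfolding set_integrable_def mult_scaleR_left .
qed

text \<open>
  Interchange the finite sum with the integral and insert the kernel formula; the factor
  \<open>N\<^sup>q\<close> is the reciprocal of the length of the cell.
\<close>

lemma walsh_partial_sum_eq_cell_integral:
  assumes "N \<ge> 2" "A \<in> carrier_mat N N" "unitary_mat A"
    and "\<And>j. j < N \<Longrightarrow> A $$ (0, j) = 1 / complex_of_real (sqrt (real N))"
    and f: "set_integrable lebesgue {0..1} f" and x: "x \<in> {0..1}"
  shows "walsh_partial_sum N A f (N ^ q) x =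
    of_nat (N ^ q) * (LINT t:adic_cell N q x|lebesgue. f t)"
proof -
  have "walsh_partial_sum N A f (N ^ q) x =
      (\<Sum>n<N ^ q. LINT t:{0..1}|lebesgue. f t * cnj (walsh N A n t) * walsh N A n x)"
    by (simp add: walsh_partial_sum_def inner01_def)
  also have "\<dots> = (LINT t:{0..1}|lebesgue. \<Sum>n<N ^ q. f t * cnj (walsh N A n t) * walsh N A n x)"
    using set_integrable_mult_cnj_walsh[OF f, of N A]
    unfolding set_lebesgue_integral_def scaleR_sum_right
    by (subst Bochner_Integration.integral_sum) (auto simp: set_integrable_def scaleR_conv_of_real mult.assoc[symmetric])
  also have "\<dots> = (LINT t:{0..1}|lebesgue.
      of_nat (N ^ q) * (indicator (adic_cell N q x) t *\<^sub>R f t))"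
  proof (intro set_lebesgue_integral_cong allI impI)
    fix t :: real assume t: "t \<in> {0..1}"
    have "(\<Sum>n<N ^ q. f t * cnj (walsh N A n t) * walsh N A n x) =
        f t * (\<Sum>n<N ^ q. walsh N A n x * cnj (walsh N A n t))"
      by (simp add: sum_distrib_left mult_ac)
    also have "\<dots> = of_nat (N ^ q) * (indicator (adic_cell N q x) t *\<^sub>R f t)"
      using t by (subst walsh_kernel[OF assms(1-4) x t]) (auto simp: adic_cell_def indicator_def)
    finally show "(\<Sum>n<N ^ q. f t * cnj (walsh N A n t) * walsh N A n x) =
        of_nat (N ^ q) * (indicator (adic_cell N q x) t *\<^sub>R f t)" .
  qed auto
  also have "\<dots> = of_nat (N ^ q) * (LINT t:{0..1}|lebesgue. indicator (adic_cell N q x) t *\<^sub>R f t)"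
    by (rule set_integral_mult_right)
  also have "(LINT t:{0..1}|lebesgue. indicator (adic_cell N q x) t *\<^sub>R f t) =
      (LINT t:adic_cell N q x|lebesgue. f t)"
    unfolding set_lebesgue_integral_def
    by (intro Bochner_Integration.integral_cong refl) (auto simp: adic_cell_def indicator_def)
  finally show ?thesis .
qed

text \<open>
  A mean of \<open>f\<close> over the cell of \<open>x\<close> is within \<open>e\<close> of \<open>f(x)\<close> as soon as all values on the cell are,
  and the whole cell lies within distance \<open>N\<^sup>-\<^sup>q\<close> of \<open>x\<close>.
\<close>

lemma walsh_partial_sum_approx:
  assumes "N \<ge> 2" "A \<in> carrier_mat N N" "unitary_mat A"
    and "\<And>j. j < N \<Longrightarrow> A $$ (0, j) = 1 / complex_of_real (sqrt (real N))"
    and f: "set_integrable lebesgue {0..1} f" and x: "x \<in> {0..1}"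
    and osc: "\<And>t. t \<in> {0..1} \<Longrightarrow> \<bar>t - x\<bar> \<le> 1 / real N ^ q \<Longrightarrow> norm (f t - f x) \<le> e"
  shows "norm (walsh_partial_sum N A f (N ^ q) x - f x) \<le> e"
proof -
  define I where "I = adic_cell N q x"
  have N: "N > 0" using assms(1) by simp
  note cell = adic_cell_properties[OF N x, where q = q, folded I_def]
  have I: "I \<in> sets lebesgue" "emeasure lebesgue I \<noteq> \<infinity>"
    using cell(1) by (auto simp: fmeasurable_def)
  have fI: "set_integrable lebesgue I f"
    using f I(1) cell(4) by (rule set_integrable_subset)
  have cI: "set_integrable lebesgue I (\<lambda>_. c)" for c :: "'b :: {banach, second_countable_topology}"
    using I unfolding set_integrable_def by (simp add: less_top[symmetric])
  have dI: "set_integrable lebesgue I (\<lambda>t. f t - f x)"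
    by (rule set_integral_diff(1)[OF fI cI])
  have mean_f: "walsh_partial_sum N A f (N ^ q) x = of_nat (N ^ q) * (LINT t:I|lebesgue. f t)"
    unfolding I_def by (rule walsh_partial_sum_eq_cell_integral[OF assms(1-6)])
  have K: "of_nat (N ^ q) * complex_of_real (measure lebesgue I) = 1" using N cell(2) by simp
  have mean_const: "of_nat (N ^ q) * (LINT t:I|lebesgue. f x) = f x"
    unfolding set_integral_const[OF I] scaleR_conv_of_real mult.assoc[symmetric] K by simp
  have "walsh_partial_sum N A f (N ^ q) x - f x =
      of_nat (N ^ q) * ((LINT t:I|lebesgue. f t) - (LINT t:I|lebesgue. f x))"
    unfolding right_diff_distrib mean_const mean_f by (rule refl)
  also have "\<dots> = of_nat (N ^ q) * (LINT t:I|lebesgue. f t - f x)"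
    by (subst set_integral_diff(2)[OF fI cI]) (rule refl)
  finally have diff: "walsh_partial_sum N A f (N ^ q) x - f x =
      of_nat (N ^ q) * (LINT t:I|lebesgue. f t - f x)" .
  have "norm (LINT t:I|lebesgue. f t - f x) \<le> (LINT t:I|lebesgue. norm (f t - f x))"
    by (rule set_integral_norm_bound[OF dI])
  also have "\<dots> \<le> (LINT t:I|lebesgue. e)"
  proof (rule set_integral_mono[OF set_integrable_norm[OF dI] cI])
    fix t assume t: "t \<in> I"
    show "norm (f t - f x) \<le> e" using osc[OF subsetD[OF cell(4) t] cell(3)[OF t]] .
  qed
  also have "\<dots> = e / real (N ^ q)"
    using cell(2) by (simp add: set_integral_const[OF I])
  finally have "real (N ^ q) * norm (LINT t:I|lebesgue. f t - f x) \<le>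
      real (N ^ q) * (e / real (N ^ q))"
    by (rule mult_left_mono) simp
  also have "\<dots> = e" using N by simp
  finally have "real (N ^ q) * norm (LINT t:I|lebesgue. f t - f x) \<le> e" .
  thus ?thesis by (simp only: diff norm_mult norm_of_nat)
qed

section \<open>Uniform convergence near a point of continuity\<close>

theorem corollary2p2:
  fixes N :: nat and A :: "complex mat" and f :: "real \<Rightarrow> complex" and a :: real
  assumes "N \<ge> 2"
    and "A \<in> carrier_mat N N"
    and "unitary_mat A"
    and "\<And>j. j < N \<Longrightarrow> A $$ (0, j) = 1 / complex_of_real (sqrt (real N))"
    and "set_integrable lebesgue {0..1} f"
    and "a \<in> {0..1}"
    and "\<exists>U. open U \<and> a \<in> U \<and> continuous_on (U \<inter> {0..1}) f"
  shows "\<exists>\<delta>>0. uniform_limit ({a - \<delta> <..< a + \<delta>} \<inter> {0..1})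
           (\<lambda>q x. walsh_partial_sum N A f (N ^ q) x) f sequentially"
proof -
  obtain U where U: "open U" "a \<in> U" "continuous_on (U \<inter> {0..1}) f" using assms(7) by blast
  obtain r where r: "r > 0" "cball a r \<subseteq> U" using U open_contains_cball by blast
  \<comment> \<open>Half the radius of continuity, so that the cell of a point \<open>\<delta>\<close>-close to \<open>a\<close> still lies in
    the compact set of uniform continuity once \<open>N\<^sup>-\<^sup>q < \<delta>\<close>.\<close>
  define \<delta> where "\<delta> = r / 2"
  have "compact (cball a r \<inter> {0..1})" by (intro compact_Int) auto
  moreover have "continuous_on (cball a r \<inter> {0..1}) f"
    using U(3) by (rule continuous_on_subset) (use r in auto)
  ultimately have uc: "uniformly_continuous_on (cball a r \<inter> {0..1}) f"
    by (rule compact_uniformly_continuous[rotated])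
  have "uniform_limit ({a - \<delta> <..< a + \<delta>} \<inter> {0..1})
      (\<lambda>q x. walsh_partial_sum N A f (N ^ q) x) f sequentially"
  proof (rule uniform_limitI)
    fix e :: real assume e: "e > 0"
    obtain d where d: "d > 0" "\<And>x t. x \<in> cball a r \<inter> {0..1} \<Longrightarrow> t \<in> cball a r \<inter> {0..1} \<Longrightarrow>
        dist t x < d \<Longrightarrow> dist (f t) (f x) < e / 2"
      using uniformly_continuous_onE[OF uc, of "e / 2"] e by (metis half_gt_zero)
    have "(\<lambda>q. 1 / real N ^ q) \<longlonglongrightarrow> 0"
      using LIMSEQ_inverse_realpow_zero[of "real N"] assms(1) by (simp add: divide_inverse)
    hence "\<forall>\<^sub>F q in sequentially. 1 / real N ^ q < min d \<delta>"
      using d r by (intro order_tendstoD) (auto simp: \<delta>_def)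
    thus "\<forall>\<^sub>F q in sequentially. \<forall>x\<in>{a - \<delta> <..< a + \<delta>} \<inter> {0..1}.
        dist (walsh_partial_sum N A f (N ^ q) x) (f x) < e"
    proof (eventually_elim, intro ballI)
      fix q x assume q: "1 / real N ^ q < min d \<delta>" and x: "x \<in> {a - \<delta> <..< a + \<delta>} \<inter> {0..1}"
      have "norm (walsh_partial_sum N A f (N ^ q) x - f x) \<le> e / 2"
      proof (rule walsh_partial_sum_approx[OF assms(1-5)])
        fix t assume t: "t \<in> {0..1}" "\<bar>t - x\<bar> \<le> 1 / real N ^ q"
        have "x \<in> cball a r" "t \<in> cball a r" "dist t x < d"
          using x t q r by (auto simp: dist_real_def \<delta>_def)
        thus "norm (f t - f x) \<le> e / 2"
          using d(2)[of x t] x t by (auto simp: dist_norm)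
      qed (use x in auto)
      thus "dist (walsh_partial_sum N A f (N ^ q) x) (f x) < e" using e by (simp add: dist_norm)
    qed
  qed
  thus ?thesis using r by (intro exI[of _ \<delta>]) (simp add: \<delta>_def)
qed

end
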